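(* Let $E_{2,6}(x_1,\ldots,x_6)=\sum_{1\le i<j\le 6}x_ix_j$ be the elementary symmetric polynomial of degree 2 in six variables, and let $\beta$ be real. The function $E_{2,6}^{-\beta}$ is completely monotone on $(0,\infty)^6$ if and only if $\beta=0$ or $\beta\ge 2$.
   Context: A $C^\infty$ function $f$ on $(0,\infty)^n$ is completely monotone if $(-1)^k\,\partial^kf/\partial x_{i_1}\cdots\partial x_{i_k}\ge 0$ everywhere on $(0,\infty)^n$ for all $k\ge 0$ and all indices $i_1,\ldots,i_k$. *)

theory Defs
  imports "HOL-Analysis.Analysis"
begin

definition partial_deriv :: "'n \<Rightarrow> (real^'n \<Rightarrow> real) \<Rightarrow> real^'n \<Rightarrow> real" where
  "partial_deriv i f x = deriv (\<lambda>t. f (x + t *\<^sub>R axis i 1)) 0"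

definition has_partial_deriv_at :: "'n \<Rightarrow> (real^'n \<Rightarrow> real) \<Rightarrow> real^'n \<Rightarrow> bool" where
  "has_partial_deriv_at i f x \<longleftrightarrow> (\<lambda>t::real. f (x + t *\<^sub>R axis i 1)) differentiable (at 0)"

(* For is = [i1, ..., ik], the derivative d^k f / (dx_i1 ... dx_ik), with dx_ik taken first. *)
definition iter_partial :: "'n list \<Rightarrow> (real^'n \<Rightarrow> real) \<Rightarrow> real^'n \<Rightarrow> real" where
  "iter_partial is f = foldr partial_deriv is f"

(* Meant for open S: the partial derivatives of every order exist and are continuous on S.
   The derivatives are taken within the whole space, so on an open S they depend only on
   the values of f on S. *)
definition smooth_on :: "(real^'n) set \<Rightarrow> (real^'n \<Rightarrow> real) \<Rightarrow> bool" where
  "smooth_on S f \<longleftrightarrow>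
     (\<forall>is. continuous_on S (iter_partial is f) \<and>
           (\<forall>i. \<forall>x\<in>S. has_partial_deriv_at i (iter_partial is f) x))"

definition pos_orthant :: "(real^'n) set" where
  "pos_orthant = {x. \<forall>i. 0 < x $ i}"

definition completely_monotone :: "(real^'n \<Rightarrow> real) \<Rightarrow> bool" where
  "completely_monotone f \<longleftrightarrow>
     smooth_on pos_orthant f \<and>
     (\<forall>is. \<forall>x\<in>pos_orthant. (-1) ^ length is * iter_partial is f x \<ge> 0)"

(* The order on the six-element index type 6 is that of the representatives 0, ..., 5. *)
definition E_2_6 :: "real^6 \<Rightarrow> real" where
  "E_2_6 x = (\<Sum>(i, j) | i < j. x $ i * x $ j)"

end

theory Submission
  imports Defs "HOL-Probability.Distributions"
begin

text \<open>
  Write \<open>S = x\<^sub>1 + \<dots> + x\<^sub>5\<close> and \<open>E = x\<^sub>0 S + E'\<close>. The Gamma integral gives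
  \<open>\<Gamma>(\<beta>) E\<^sup>-\<^sup>\<beta> = \<integral> s\<^sup>\<beta>\<^sup>-\<^sup>1 S\<^sup>-\<^sup>\<beta> exp (- s E / S) ds\<close> over \<open>s > 0\<close>. If \<open>q\<^sub>1, \<dots>, q\<^sub>5\<close> are the vertices
  of a regular simplex in four-dimensional space with squared edge length 2, then \<open>E' / S\<close> is half
  the moment of inertia of the masses \<open>x\<^sub>i\<close> at \<open>q\<^sub>i\<close> about their barycentre. Hence
  \<open>S\<^sup>-\<^sup>2 exp (- s E' / S)\<close> is, up to a constant, the Gaussian integral over \<open>z\<close> of
  \<open>exp (- \<Sum> x\<^sub>i |z - sqrt s q\<^sub>i|\<^sup>2 / 2)\<close>, a mixture of decreasing exponentials, and the remaining
  factor \<open>S\<^sup>-\<^sup>(\<^sup>\<beta>\<^sup>-\<^sup>2\<^sup>)\<close> is completely monotone for \<open>\<beta> \<ge> 2\<close>.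

  Conversely, \<open>\<beta> < 0\<close> gives an increasing function, so let \<open>\<beta> > 0\<close>. By Euler's identity for
  homogeneous functions, the normalised signed derivatives at \<open>(1, \<dots>, 1)\<close> are the
  finite-dimensional distributions of an exchangeable sequence \<open>I\<^sub>1, I\<^sub>2, \<dots>\<close> of indices. The
  variance of the frequency of the event \<open>I\<^sub>2\<^sub>k\<^sub>-\<^sub>1 = I\<^sub>2\<^sub>k\<close> is nonnegative, so in the limit
  \<open>P (I\<^sub>1 = I\<^sub>2)\<^sup>2 \<le> P (I\<^sub>1 = I\<^sub>2, I\<^sub>3 = I\<^sub>4)\<close>. Both sides are explicit rational functions of \<open>\<beta>\<close>,
  and the inequality amounts to \<open>\<beta> \<ge> 2\<close>.
\<close>

section \<open>The quadratic form\<close>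

lemma UNIV_6: "(UNIV::6 set) = {0,1,2,3,4,5}"
proof -
  have "card {0,1,2,3,4,5::6} = CARD(6)" by simp
  then show ?thesis by (metis card_subset_eq finite subset_UNIV)
qed
lemma E_2_6_eq: "E_2_6 x = ((\<Sum>i\<in>UNIV. x $ i)\<^sup>2 - (\<Sum>i\<in>UNIV. (x $ i)\<^sup>2)) / 2"
proof -
  let ?f = "\<lambda>(i, j). x $ i * x $ j"
  have "(\<Sum>i\<in>UNIV. x $ i)\<^sup>2 = sum ?f (UNIV \<times> UNIV)"
    by (simp add: power2_eq_square sum_product sum.cartesian_product)
  also have "UNIV \<times> UNIV = {(i, j). i < j} \<union> {(i, j). j < i} \<union> {(i, j). i = (j::6)}"
    by auto
  also have "sum ?f \<dots> = sum ?f {(i, j). i < j} + sum ?f {(i, j). j < i} + sum ?f {(i, j). i = j}"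
    by (subst sum.union_disjoint, auto)+
  also have "sum ?f {(i, j). j < i} = sum ?f {(i, j). i < j}"
    by (rule sum.reindex_bij_witness[of _ prod.swap prod.swap]) auto
  also have "sum ?f {(i, j). i = j} = (\<Sum>i\<in>UNIV. (x $ i)\<^sup>2)"
    by (rule sum.reindex_bij_witness[of _ "\<lambda>i. (i, i)" fst]) (auto simp: power2_eq_square)
  finally show ?thesis by (simp add: E_2_6_def)
qed

lemma sum_6: "(\<Sum>i\<in>UNIV. f (i::6)) = f 0 + f 1 + f 2 + f 3 + f 4 + f 5"
  unfolding UNIV_6 by (simp add: add.assoc)

lemma E_2_6_pos:
  assumes "x \<in> pos_orthant" shows "0 < E_2_6 x"
proof -
  have "0 < x $ i" for i using assms by (simp add: pos_orthant_def)
  then have "0 < x $ i * x $ j" for i j by simp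
  moreover have "{(i, j). i < (j::6)} \<noteq> {}"
    using neqE[of "0::6" 1] by force
  ultimately show ?thesis
    unfolding E_2_6_def by (intro sum_pos) (auto simp: case_prod_beta)
qed

lemma shift_axis_component:
  "(x + t *\<^sub>R axis i 1) $ j = x $ j + (if j = i then t else (0::real))"
  by (simp add: axis_def)

lemma sum_shift_axis:
  "(\<Sum>j\<in>UNIV. (x + t *\<^sub>R axis i 1) $ j) = (\<Sum>j\<in>UNIV. x $ j) + (t::real)"
  unfolding shift_axis_component by (simp add: sum.distrib)

text \<open>The quadratic terms in \<open>t\<close> from the square of the sum and from the sum of
  squares cancel: \<open>E_2_6\<close> is affine along each axis.\<close>

lemma E_2_6_shift_axis:
  "E_2_6 (x + t *\<^sub>R axis i 1) = E_2_6 x + t * ((\<Sum>j\<in>UNIV. x $ j) - x $ i)"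
proof -
  have "((x + t *\<^sub>R axis i 1) $ j)\<^sup>2 = (x $ j)\<^sup>2 + (if j = i then 2 * t * x $ i + t\<^sup>2 else 0)" for j
    by (auto simp: axis_def power2_eq_square algebra_simps)
  then have "(\<Sum>j\<in>UNIV. ((x + t *\<^sub>R axis i 1) $ j)\<^sup>2) = (\<Sum>j\<in>UNIV. (x $ j)\<^sup>2) + 2 * t * x $ i + t\<^sup>2"
    by (simp add: sum.distrib)
  then show ?thesis
    unfolding E_2_6_eq sum_shift_axis by (simp add: power2_eq_square field_simps)
qed

lemma continuous_on_E_2_6 [continuous_intros]: "continuous_on S E_2_6"
  unfolding E_2_6_eq[abs_def] by (intro continuous_intros) auto

section \<open>Alternating finite differences\<close>

text \<open>
  \<open>alternating n\<close> is the finite-difference form of complete monotonicity up to order \<open>n\<close>.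
  Unlike the differential form it passes to integrals and pointwise limits, so nothing has to be
  differentiated under an integral sign.
\<close>

definition bdiff :: "'n \<Rightarrow> real \<Rightarrow> (real^'n \<Rightarrow> real) \<Rightarrow> real^'n \<Rightarrow> real" where
  "bdiff i h f x = f x - f (x + h *\<^sub>R axis i 1)"

primrec alternating :: "nat \<Rightarrow> (real^'n \<Rightarrow> real) \<Rightarrow> bool" where
  "alternating 0 f \<longleftrightarrow> (\<forall>x\<in>pos_orthant. 0 \<le> f x)"
| "alternating (Suc n) f \<longleftrightarrow>
     (\<forall>x\<in>pos_orthant. 0 \<le> f x) \<and> (\<forall>i h. 0 < h \<longrightarrow> alternating n (bdiff i h f))"

lemma pos_orthant_shift: "x \<in> pos_orthant \<Longrightarrow> 0 \<le> h \<Longrightarrow> x + h *\<^sub>R axis i 1 \<in> pos_orthant"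
  by (auto simp: pos_orthant_def axis_def add_pos_nonneg)

lemma alternating_nonneg: "alternating n f \<Longrightarrow> x \<in> pos_orthant \<Longrightarrow> 0 \<le> f x"
  by (cases n) auto

lemma alternating_cong:
  assumes "alternating n f" "\<And>x. x \<in> pos_orthant \<Longrightarrow> f x = g x"
  shows "alternating n g"
  using assms
proof (induction n arbitrary: f g)
  case (Suc n)
  have "alternating n (bdiff i h g)" if "0 < h" for i h
  proof (rule Suc.IH)
    show "alternating n (bdiff i h f)" using Suc.prems(1) that by simp
    show "bdiff i h f x = bdiff i h g x" if "x \<in> pos_orthant" for x
      using that Suc.prems(2) pos_orthant_shift[of x h i] \<open>0 < h\<close> by (simp add: bdiff_def)
  qed
  then show ?case using Suc.prems by auto
qed auto

lemma alternating_Suc_D: "alternating (Suc n) f \<Longrightarrow> alternating n f"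
  by (induction n arbitrary: f) auto

lemma alternating_shift:
  "alternating n f \<Longrightarrow> 0 \<le> h \<Longrightarrow> alternating n (\<lambda>x. f (x + h *\<^sub>R axis i 1))"
proof (induction n arbitrary: f)
  case (Suc n)
  have "alternating n (bdiff j k (\<lambda>x. f (x + h *\<^sub>R axis i 1)))" if "0 < k" for j k
  proof -
    have "alternating n (\<lambda>x. bdiff j k f (x + h *\<^sub>R axis i 1))"
      using Suc that by simp
    then show ?thesis
      by (rule alternating_cong) (simp add: bdiff_def add_ac)
  qed
  then show ?case using Suc.prems by (auto simp: pos_orthant_shift)
qed (auto simp: pos_orthant_shift)

lemma alternating_add:
  "alternating n f \<Longrightarrow> alternating n g \<Longrightarrow> alternating n (\<lambda>x. f x + g x)"
proof (induction n arbitrary: f g)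
  case (Suc n)
  have "alternating n (bdiff i h (\<lambda>x. f x + g x))" if "0 < h" for i h
  proof -
    have "alternating n (\<lambda>x. bdiff i h f x + bdiff i h g x)"
      using Suc that by simp
    then show ?thesis
      by (rule alternating_cong) (simp add: bdiff_def)
  qed
  then show ?case using Suc.prems by auto
qed auto

lemma alternating_mult:
  "alternating n f \<Longrightarrow> alternating n g \<Longrightarrow> alternating n (\<lambda>x. f x * g x)"
proof (induction n arbitrary: f g)
  case (Suc n)
  have "alternating n (bdiff i h (\<lambda>x. f x * g x))" if "0 < h" for i h
  proof -
    \<comment> \<open>Discrete Leibniz rule; its factor at the shifted point calls for
      \<open>alternating_shift\<close>.\<close>
    have "alternating n (\<lambda>x. bdiff i h f x * g x + f (x + h *\<^sub>R axis i 1) * bdiff i h g x)"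
      using Suc that by (intro alternating_add Suc.IH alternating_shift)
        (auto intro: alternating_Suc_D simp del: alternating.simps(2), auto)
    then show ?thesis
      by (rule alternating_cong) (simp add: bdiff_def algebra_simps)
  qed
  then show ?case using Suc.prems by auto
qed auto

lemma alternating_const: "0 \<le> c \<Longrightarrow> alternating n (\<lambda>x. c)"
proof (induction n arbitrary: c)
  case (Suc n)
  have "bdiff i h (\<lambda>x. c) = (\<lambda>x. 0)" for i :: 'a and h
    by (simp add: bdiff_def fun_eq_iff)
  then show ?case using Suc by auto
qed auto

lemma alternating_cmult_D:
  assumes "alternating n (\<lambda>x. c * f x)" "0 < c"
  shows "alternating n f"
proof (rule alternating_cong)
  show "alternating n (\<lambda>x. inverse c * (c * f x))"
    by (rule alternating_mult[OF alternating_const assms(1)]) (use assms(2) in simp)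
  show "inverse c * (c * f x) = f x" for x
    using assms(2) by simp
qed

lemma alternating_prod:
  "(\<And>j. j \<in> J \<Longrightarrow> alternating n (f j)) \<Longrightarrow> alternating n (\<lambda>x. \<Prod>j\<in>J. f j x)"
  by (induction J rule: infinite_finite_induct) (auto intro: alternating_mult alternating_const)

lemma alternating_limit:
  assumes "\<And>k. alternating n (f k)" "\<And>x. x \<in> pos_orthant \<Longrightarrow> (\<lambda>k. f k x) \<longlonglongrightarrow> g x"
  shows "alternating n g"
  using assms
proof (induction n arbitrary: f g)
  case 0
  show ?case
  proof (simp, rule ballI)
    fix x :: "real^'a" assume "x \<in> pos_orthant"
    then show "0 \<le> g x"
      using 0 by (intro LIMSEQ_le_const[OF 0(2)] exI[of _ 0]) auto
  qed
next
  case (Suc n)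
  have "alternating n (bdiff i h g)" if "0 < h" for i h
  proof (rule Suc.IH)
    show "alternating n (bdiff i h (f k))" for k using Suc.prems(1) that by simp
    show "(\<lambda>k. bdiff i h (f k) x) \<longlonglongrightarrow> bdiff i h g x" if "x \<in> pos_orthant" for x
      unfolding bdiff_def using that \<open>0 < h\<close>
      by (intro tendsto_diff Suc.prems(2)) (auto intro: pos_orthant_shift)
  qed
  moreover have "0 \<le> g x" if "x \<in> pos_orthant" for x
    using Suc.prems(1) that by (intro LIMSEQ_le_const[OF Suc.prems(2)] exI[of _ 0]) auto
  ultimately show ?case by simp
qed

lemma alternating_integral:
  fixes f :: "real \<Rightarrow> real^'n \<Rightarrow> real"
  assumes "\<And>t. t \<in> T \<Longrightarrow> alternating n (f t)"
    and "\<And>x. x \<in> pos_orthant \<Longrightarrow> ((\<lambda>t. f t x) has_integral F x) T"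
  shows "alternating n F"
  using assms
proof (induction n arbitrary: f F)
  case 0
  show ?case
  proof (simp, rule ballI)
    fix x :: "real^'n" assume "x \<in> pos_orthant"
    then show "0 \<le> F x"
      using 0(1) by (intro has_integral_nonneg[OF 0(2)]) auto
  qed
next
  case (Suc n)
  have "alternating n (bdiff i h F)" if "0 < h" for i h
  proof (rule Suc.IH)
    show "alternating n (bdiff i h (f t))" if "t \<in> T" for t
      using Suc.prems(1)[OF that] \<open>0 < h\<close> by simp
    show "((\<lambda>t. bdiff i h (f t) x) has_integral bdiff i h F x) T" if "x \<in> pos_orthant" for x
      unfolding bdiff_def using that \<open>0 < h\<close>
      by (intro has_integral_diff Suc.prems(2)) (auto intro: pos_orthant_shift)
  qed
  moreover have "0 \<le> F x" if "x \<in> pos_orthant" for x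
    using Suc.prems(1) that by (intro has_integral_nonneg[OF Suc.prems(2)]) auto
  ultimately show ?case by simp
qed

text \<open>The exponential is an eigenfunction of \<open>bdiff i h\<close> with the nonnegative
  eigenvalue \<open>1 - exp (- (h * c $ i))\<close>.\<close>

lemma alternating_exp:
  assumes "\<And>i. 0 \<le> c $ i"
  shows "alternating n (\<lambda>x. exp (- (c \<bullet> x)))"
proof (induction n)
  case (Suc n)
  have "alternating n (bdiff i h (\<lambda>x. exp (- (c \<bullet> x))))" if "0 < h" for i h
  proof -
    have "alternating n (\<lambda>x. (1 - exp (- (h * c $ i))) * exp (- (c \<bullet> x)))"
      using Suc assms that by (intro alternating_mult alternating_const) auto
    then show ?thesis
      by (rule alternating_cong)
        (simp add: bdiff_def inner_add_right inner_axis algebra_simps flip: exp_add)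
  qed
  then show ?case by simp
qed auto

section \<open>From finite differences to derivatives\<close>

lemma has_partial_deriv_at_iff:
  "has_partial_deriv_at i f x \<longleftrightarrow>
     ((\<lambda>t. f (x + t *\<^sub>R axis i 1)) has_real_derivative partial_deriv i f x) (at 0)"
  unfolding has_partial_deriv_at_def partial_deriv_def
  by (rule DERIV_deriv_iff_real_differentiable[symmetric])

lemma has_partial_deriv_at_I:
  assumes "((\<lambda>t. f (x + t *\<^sub>R axis i 1)) has_real_derivative D) (at 0)"
  shows "has_partial_deriv_at i f x" "partial_deriv i f x = D"
  using assms DERIV_imp_deriv[OF assms]
  by (auto simp: has_partial_deriv_at_iff partial_deriv_def)

text \<open>The negated derivative is a limit of scaled differences \<open>bdiff i h f\<close>. A
  difference uses up one order, hence the hypothesis for all \<open>n\<close>.\<close>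

lemma alternating_partial_deriv:
  assumes f: "\<And>n. alternating n f"
    and d: "\<And>x. x \<in> pos_orthant \<Longrightarrow> has_partial_deriv_at i f x"
  shows "alternating n (\<lambda>x. - partial_deriv i f x)"
proof (rule alternating_limit)
  let ?h = "\<lambda>k. inverse (real (Suc k))"
  show "alternating n (\<lambda>x. real (Suc k) * bdiff i (?h k) f x)" for k
    using f[of "Suc n"] by (intro alternating_mult alternating_const) auto
  show "(\<lambda>k. real (Suc k) * bdiff i (?h k) f x) \<longlonglongrightarrow> - partial_deriv i f x"
    if "x \<in> pos_orthant" for x
  proof -
    have "((\<lambda>t. f (x + t *\<^sub>R axis i 1)) has_real_derivative partial_deriv i f x) (at 0)"
      using d[OF that] by (simp add: has_partial_deriv_at_iff)
    then have "((\<lambda>t. (f (x + t *\<^sub>R axis i 1) - f x) / t) \<longlongrightarrow> partial_deriv i f x) (at 0)"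
      by (simp add: DERIV_def)
    moreover have "filterlim ?h (at 0) sequentially"
      by (auto simp: filterlim_at simp del: of_nat_Suc intro: LIMSEQ_inverse_real_of_nat)
    ultimately have "(\<lambda>k. (f (x + ?h k *\<^sub>R axis i 1) - f x) / ?h k) \<longlonglongrightarrow> partial_deriv i f x"
      by (rule filterlim_compose)
    then have "(\<lambda>k. - ((f (x + ?h k *\<^sub>R axis i 1) - f x) / ?h k)) \<longlonglongrightarrow> - partial_deriv i f x"
      by (rule tendsto_minus)
    moreover have "- ((f (x + ?h k *\<^sub>R axis i 1) - f x) / ?h k)
        = real (Suc k) * bdiff i (?h k) f x" for k
      by (simp add: bdiff_def field_simps del: of_nat_Suc)
    ultimately show ?thesis by simp
  qed
qed

text \<open>The induction over the index list carries \<open>alternating n\<close> and not just the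
  sign, since each further derivative needs it of the preceding one.\<close>

lemma completely_monotone_if_alternating:
  assumes sm: "smooth_on pos_orthant f" and alt: "\<And>n. alternating n f"
  shows "completely_monotone f"
proof -
  have "alternating n (\<lambda>x. (-1) ^ length is * iter_partial is f x)" for "is" n
  proof (induction "is" arbitrary: n)
    case Nil
    then show ?case using alt by (simp add: iter_partial_def)
  next
    case (Cons i "is")
    let ?g = "\<lambda>x. (-1) ^ length is * iter_partial is f x"
    have d: "((\<lambda>t. ?g (x + t *\<^sub>R axis i 1)) has_real_derivative
        (-1) ^ length is * partial_deriv i (iter_partial is f) x) (at 0)"
      if "x \<in> pos_orthant" for x
    proof (rule DERIV_cmult)
      show "((\<lambda>t. iter_partial is f (x + t *\<^sub>R axis i 1)) has_real_derivative
          partial_deriv i (iter_partial is f) x) (at 0)"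
        using sm that unfolding smooth_on_def has_partial_deriv_at_iff by blast
    qed
    have "alternating n (\<lambda>x. - partial_deriv i ?g x)"
      using Cons has_partial_deriv_at_I(1)[OF d] by (rule alternating_partial_deriv)
    then show ?case
    proof (rule alternating_cong)
      fix x :: "real^'a" assume "x \<in> pos_orthant"
      then show "- partial_deriv i ?g x = (-1) ^ length (i # is) * iter_partial (i # is) f x"
        using has_partial_deriv_at_I(2)[OF d] by (simp add: iter_partial_def)
    qed
  qed
  then show ?thesis
    using sm alternating_nonneg unfolding completely_monotone_def by blast
qed

section \<open>Iterated partial derivatives of powers\<close>

lemma open_pos_orthant: "open (pos_orthant :: (real^'n) set)"
proof -
  have "pos_orthant = (\<Inter>i\<in>UNIV. {x :: real^'n. 0 < x $ i})"
    by (auto simp: pos_orthant_def)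
  also have "open \<dots>"
    by (intro open_INT) (auto intro: open_halfspace_component_gt_cart)
  finally show ?thesis .
qed

lemma eventually_pos_orthant_axis:
  assumes "x \<in> pos_orthant"
  shows "\<forall>\<^sub>F t in nhds 0. x + t *\<^sub>R axis i 1 \<in> pos_orthant"
proof -
  have "((\<lambda>t. x + t *\<^sub>R axis i 1) \<longlongrightarrow> x + 0 *\<^sub>R axis i 1) (nhds 0)"
    by (intro tendsto_intros) (simp add: filterlim_ident)
  then show ?thesis
    using assms open_pos_orthant by (auto dest: topological_tendstoD)
qed

lemma has_real_derivative_axis_cong:
  assumes "\<And>y. y \<in> pos_orthant \<Longrightarrow> f y = g y" "x \<in> pos_orthant"
  shows "((\<lambda>t. f (x + t *\<^sub>R axis i 1)) has_real_derivative d) (at 0) \<longleftrightarrow>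
         ((\<lambda>t. g (x + t *\<^sub>R axis i 1)) has_real_derivative d) (at 0)"
  using assms(1) by (intro DERIV_cong_ev refl eventually_mono[OF eventually_pos_orthant_axis[OF assms(2)]])

text \<open>
  A class of functions closed under partial differentiation and containing all powers of
  \<open>E_2_6\<close>; it yields smoothness and the symmetry of the mixed derivatives.
\<close>

datatype expr = Const real | Coord 6 | Total | EPow real | Add expr expr | Mul expr expr

primrec ev :: "expr \<Rightarrow> real^6 \<Rightarrow> real" where
  "ev (Const c) x = c"
| "ev (Coord i) x = x $ i"
| "ev Total x = (\<Sum>i\<in>UNIV. x $ i)"
| "ev (EPow c) x = E_2_6 x powr c"
| "ev (Add a b) x = ev a x + ev b x"
| "ev (Mul a b) x = ev a x * ev b x"

primrec pd :: "6 \<Rightarrow> expr \<Rightarrow> expr" where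
  "pd i (Const c) = Const 0"
| "pd i (Coord j) = Const (if i = j then 1 else 0)"
| "pd i Total = Const 1"
| "pd i (EPow c) = Mul (Const c) (Mul (EPow (c - 1)) (Add Total (Mul (Const (-1)) (Coord i))))"
| "pd i (Add a b) = Add (pd i a) (pd i b)"
| "pd i (Mul a b) = Add (Mul (pd i a) b) (Mul a (pd i b))"

lemma has_real_derivative_ev:
  assumes "x \<in> pos_orthant"
  shows "((\<lambda>t. ev e (x + t *\<^sub>R axis i 1)) has_real_derivative ev (pd i e) x) (at 0)"
proof (induction e)
  case (EPow c)
  show ?case
    using E_2_6_pos[OF assms] unfolding ev.simps pd.simps E_2_6_shift_axis
    by (auto intro!: derivative_eq_intros)
next
  case (Mul a b)
  then show ?case by (auto intro!: derivative_eq_intros)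
next
  case (Coord j)
  show ?case
    unfolding ev.simps pd.simps shift_axis_component by (auto intro!: derivative_eq_intros)
next
  case Total
  show ?case
    unfolding ev.simps pd.simps sum_shift_axis by (auto intro!: derivative_eq_intros)
next
  case (Add a b)
  then show ?case unfolding ev.simps pd.simps by (rule DERIV_add)
qed simp

lemma iter_partial_ev:
  "x \<in> pos_orthant \<Longrightarrow> iter_partial is (ev e) x = ev (foldr pd is e) x"
proof (induction "is" arbitrary: x)
  case (Cons i "is")
  show ?case
    using has_partial_deriv_at_I(2)[OF has_real_derivative_axis_cong[THEN iffD2, OF Cons.IH
        Cons.prems has_real_derivative_ev[OF Cons.prems]]]
    by (simp add: iter_partial_def)
qed (simp add: iter_partial_def)

lemma continuous_on_ev: "continuous_on pos_orthant (ev e)"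
proof (induction e)
  case (EPow c)
  show ?case
    unfolding ev.simps[abs_def]
    by (intro continuous_intros) (auto dest: E_2_6_pos)
next
  case (Add a b)
  then show ?case unfolding ev.simps[abs_def] by (rule continuous_on_add)
next
  case (Mul a b)
  then show ?case unfolding ev.simps[abs_def] by (rule continuous_on_mult)
next
  case Total
  show ?case
    unfolding ev.simps[abs_def] by (intro continuous_on_sum continuous_on_component continuous_on_id)
next
  case (Coord i)
  show ?case
    unfolding ev.simps[abs_def] by (intro continuous_on_component continuous_on_id)
qed simp

lemma smooth_on_ev: "smooth_on pos_orthant (ev e)"
  unfolding smooth_on_def
proof (intro allI conjI ballI)
  fix "is" show "continuous_on pos_orthant (iter_partial is (ev e))"
    using continuous_on_ev by (rule continuous_on_eq) (simp add: iter_partial_ev)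
  fix i x assume x: "x \<in> (pos_orthant :: (real^6) set)"
  show "has_partial_deriv_at i (iter_partial is (ev e)) x"
    using has_real_derivative_axis_cong[THEN iffD2, OF iter_partial_ev x
        has_real_derivative_ev[OF x]]
    by (rule has_partial_deriv_at_I)
qed

section \<open>Symmetry of mixed derivatives and Euler's identity\<close>

lemma pd_cong:
  assumes "\<And>y. y \<in> pos_orthant \<Longrightarrow> ev a y = ev b y" "x \<in> pos_orthant"
  shows "ev (pd i a) x = ev (pd i b) x"
proof (rule DERIV_unique)
  show "((\<lambda>t. ev a (x + t *\<^sub>R axis i 1)) has_real_derivative ev (pd i a) x) (at 0)"
    by (rule has_real_derivative_ev[OF assms(2)])
  show "((\<lambda>t. ev a (x + t *\<^sub>R axis i 1)) has_real_derivative ev (pd i b) x) (at 0)"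
    using has_real_derivative_axis_cong[of "ev a" "ev b", OF assms]
      has_real_derivative_ev[OF assms(2)] by blast
qed

lemma pd_commute: "ev (pd i (pd j e)) x = ev (pd j (pd i e)) x"
proof (induction e)
  case (EPow c)
  define s where "s = (\<Sum>i\<in>UNIV. x $ i)"
  show ?case
    unfolding pd.simps ev.simps s_def[symmetric] by (cases "i = j") (simp_all add: algebra_simps)
next
  case (Mul a b)
  show ?case unfolding pd.simps ev.simps Mul by simp
next
  case (Add a b)
  show ?case unfolding pd.simps ev.simps Add by simp
next
  case (Coord k)
  show ?case unfolding pd.simps ev.simps by simp
next
  case Total
  show ?case unfolding pd.simps ev.simps by simp
next
  case (Const c)
  show ?case unfolding pd.simps ev.simps by simp
qed

lemma foldr_pd_cong:
  assumes "\<And>y. y \<in> pos_orthant \<Longrightarrow> ev a y = ev b y" "x \<in> pos_orthant"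
  shows "ev (foldr pd is a) x = ev (foldr pd is b) x"
  using assms(2)
proof (induction "is" arbitrary: x)
  case Nil
  then show ?case by (simp add: assms(1))
next
  case (Cons i "is")
  then show ?case using pd_cong[of "foldr pd is a" "foldr pd is b" x i] by simp
qed

lemma foldr_pd_swap:
  "x \<in> pos_orthant \<Longrightarrow> ev (foldr pd (s @ i # j # r) e) x = ev (foldr pd (s @ j # i # r) e) x"
  using foldr_pd_cong[of "foldr pd (i # j # r) e" "foldr pd (j # i # r) e" x s]
  by (simp add: pd_commute)

text \<open>Differentiating Euler's identity along axis \<open>j\<close> gives one extra copy of
  \<open>ev (pd j e) x\<close>, from the term \<open>i = j\<close>; moving it to the right lowers
  the degree by one.\<close>

lemma euler_pd:
  assumes "\<And>y. y \<in> pos_orthant \<Longrightarrow> (\<Sum>i\<in>UNIV. y $ i * ev (pd i e) y) = d * ev e y"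
    and "x \<in> pos_orthant"
  shows "(\<Sum>i\<in>UNIV. x $ i * ev (pd i (pd j e)) x) = (d - 1) * ev (pd j e) x"
proof -
  have "((\<lambda>t. \<Sum>i\<in>UNIV. ev (Mul (Coord i) (pd i e)) (x + t *\<^sub>R axis j 1))
      has_real_derivative (\<Sum>i\<in>UNIV. ev (pd j (Mul (Coord i) (pd i e))) x)) (at 0)"
    by (rule DERIV_sum) (rule has_real_derivative_ev[OF assms(2)])
  moreover have "((\<lambda>t. \<Sum>i\<in>UNIV. ev (Mul (Coord i) (pd i e)) (x + t *\<^sub>R axis j 1))
      has_real_derivative d * ev (pd j e) x) (at 0)"
  proof (rule has_real_derivative_axis_cong[where g = "\<lambda>y. d * ev e y", THEN iffD2, OF _ assms(2)])
    show "(\<Sum>i\<in>UNIV. ev (Mul (Coord i) (pd i e)) y) = d * ev e y" if "y \<in> pos_orthant" for y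
      using assms(1)[OF that] by simp
    show "((\<lambda>t. d * ev e (x + t *\<^sub>R axis j 1)) has_real_derivative d * ev (pd j e) x) (at 0)"
      by (rule DERIV_cmult[OF has_real_derivative_ev[OF assms(2)]])
  qed
  ultimately have "(\<Sum>i\<in>UNIV. ev (pd j (Mul (Coord i) (pd i e))) x) = d * ev (pd j e) x"
    by (rule DERIV_unique)
  moreover have "(\<Sum>i\<in>UNIV. ev (pd j (Mul (Coord i) (pd i e))) x)
      = (\<Sum>i\<in>UNIV. (if j = i then ev (pd j e) x else 0) + x $ i * ev (pd i (pd j e)) x)"
    by (intro sum.cong) (auto simp: pd_commute[of j])
  ultimately show ?thesis
    by (simp add: sum.distrib algebra_simps)
qed

lemma euler_EPow:
  assumes "x \<in> pos_orthant"
  shows "(\<Sum>i\<in>UNIV. x $ i * ev (pd i (foldr pd is (EPow c))) x)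
    = (2 * c - real (length is)) * ev (foldr pd is (EPow c)) x"
  using assms
proof (induction "is" arbitrary: x)
  case Nil
  let ?s = "\<Sum>i\<in>UNIV. x $ i"
  have "(\<Sum>i\<in>UNIV. x $ i * ev (pd i (EPow c)) x)
      = (\<Sum>i\<in>UNIV. c * E_2_6 x powr (c - 1) * (x $ i * (?s - x $ i)))"
    by (intro sum.cong) simp_all
  also have "\<dots> = c * E_2_6 x powr (c - 1) * (\<Sum>i\<in>UNIV. x $ i * (?s - x $ i))"
    by (rule sum_distrib_left[symmetric])
  also have "(\<Sum>i\<in>UNIV. x $ i * (?s - x $ i)) = 2 * E_2_6 x"
    unfolding E_2_6_eq
    by (simp add: right_diff_distrib sum_subtractf power2_eq_square flip: sum_distrib_right)
  also have "c * E_2_6 x powr (c - 1) * (2 * E_2_6 x) = 2 * c * E_2_6 x powr c"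
    using E_2_6_pos[OF Nil] by (simp add: powr_diff)
  finally show ?case by simp
next
  case (Cons j "is")
  then show ?case
    using euler_pd[of "foldr pd is (EPow c)" "2 * c - real (length is)" x j]
    by (simp add: algebra_simps)
qed

section \<open>Exchangeability and necessity\<close>

text \<open>Read \<open>q r\<close> as the probability of the word \<open>r\<close>. The variance of
  the number of visits to \<open>A\<close> among \<open>N\<close> letters is nonnegative; divided by
  the square of \<open>N\<close>, it tends to the right-hand side minus the left-hand side.\<close>

lemma exchangeable_second_moment:
  fixes q :: "'b::finite list \<Rightarrow> real" and A :: "'b set"
  assumes nonneg: "\<And>r. 0 \<le> q r"
    and total: "q [] = 1"
    and marginal: "\<And>r. (\<Sum>p\<in>UNIV. q (p # r)) = q r"
    and swap: "\<And>s p p' r. q (s @ p # p' # r) = q (s @ p' # p # r)"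
  shows "(\<Sum>p\<in>A. q [p])\<^sup>2 \<le> (\<Sum>p\<in>A. \<Sum>p'\<in>A. q [p', p])"
proof -
  \<comment> \<open>\<open>s1 r\<close> and \<open>s2 r\<close> are the probabilities of
    \<open>r\<close> together with one and two further letters in \<open>A\<close>.\<close>
  define s1 where "s1 r = (\<Sum>p\<in>A. q (p # r))" for r
  define s2 where "s2 r = (\<Sum>p\<in>A. s1 (p # r))" for r
  have swap0: "q (p # p' # r) = q (p' # p # r)" for p p' r
    using swap[of "[]"] by simp
  have swap1: "q (p'' # p # p' # r) = q (p'' # p' # p # r)" for p p' p'' r
    using swap[of "[p'']"] by simp
  have s1: "(\<Sum>p\<in>UNIV. s1 (p # r)) = s1 r" for r
    unfolding s1_def by (subst sum.swap, subst swap0) (simp add: marginal)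
  have "(\<Sum>p\<in>UNIV. s1 (p' # p # r)) = s1 (p' # r)" for p' r
    unfolding s1_def by (subst sum.swap, subst swap1, subst swap0) (simp add: marginal)
  then have s2: "(\<Sum>p\<in>UNIV. s2 (p # r)) = s2 r" for r
    unfolding s2_def by (subst sum.swap) simp
  have UA: "(\<Sum>p\<in>UNIV. of_bool (p \<in> A) * f p) = sum f A" for f :: "'b \<Rightarrow> real"
    by (simp add: of_bool_def if_distrib sum.If_cases if_distribR cong: if_cong)
  \<comment> \<open>For \<open>r = []\<close> the right-hand side is the expectation of the square of \<open>a\<close> plus the number
    of visits to \<open>A\<close> among the first \<open>N\<close> terms of the exchangeable sequence with law \<open>q\<close>.\<close>
  have pos: "0 \<le> a\<^sup>2 * q r + (2 * a + 1) * real N * s1 r + real N * (real N - 1) * s2 r" for a r N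
  \<comment> \<open>Conditioning on the next letter \<open>p\<close> adds its indicator to
    \<open>a\<close> and extends \<open>r\<close>, so both must vary.\<close>
  proof (induction N arbitrary: a r)
    case 0
    show ?case using nonneg by simp
  next
    case (Suc N)
    let ?\<chi> = "\<lambda>p. of_bool (p \<in> A) :: real"
    have "0 \<le> (\<Sum>p\<in>UNIV. (a + ?\<chi> p)\<^sup>2 * q (p # r)
        + (2 * (a + ?\<chi> p) + 1) * real N * s1 (p # r) + real N * (real N - 1) * s2 (p # r))"
      by (intro sum_nonneg Suc.IH)
    also have "\<dots> = (\<Sum>p\<in>UNIV. a\<^sup>2 * q (p # r) + (2 * a + 1) * (?\<chi> p * q (p # r))
        + (2 * a + 1) * real N * s1 (p # r) + 2 * real N * (?\<chi> p * s1 (p # r))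
        + real N * (real N - 1) * s2 (p # r))"
      by (intro sum.cong refl) (auto simp: power2_eq_square algebra_simps)
    also have "\<dots> = a\<^sup>2 * q r + (2 * a + 1) * s1 r + (2 * a + 1) * real N * s1 r
        + 2 * real N * s2 r + real N * (real N - 1) * s2 r"
      unfolding sum.distrib sum_distrib_left[symmetric] UA marginal s1 s2
      by (simp add: s1_def s2_def)
    also have "\<dots> = a\<^sup>2 * q r + (2 * a + 1) * real (Suc N) * s1 r
        + real (Suc N) * (real (Suc N) - 1) * s2 r"
      by (simp add: algebra_simps)
    finally show ?case .
  qed
  have "(s1 [])\<^sup>2 \<le> s2 []"
  proof (rule ccontr)
    assume "\<not> ?thesis"
    then have "0 < (s1 [])\<^sup>2 - s2 []" by simp
    \<comment> \<open>The Archimedean property replaces the limit: this \<open>N\<close> will make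
      the variance negative.\<close>
    then obtain N where N: "s1 [] - s2 [] < real N * ((s1 [])\<^sup>2 - s2 [])"
      using reals_Archimedean3 by blast
    have "0 \<le> s2 []"
      unfolding s2_def s1_def by (intro sum_nonneg nonneg)
    have "N > 0"
    proof (rule ccontr)
      assume "\<not> N > 0"
      then have "s1 [] < s2 []" using N by simp
      moreover have "s2 [] \<le> s1 []"
        unfolding s1[of "[]", symmetric] s2_def
        by (intro sum_mono2) (auto simp: s1_def intro: sum_nonneg nonneg)
      ultimately show False by simp
    qed
    \<comment> \<open>With \<open>a\<close> equal to minus the mean number of visits,
      \<open>pos\<close> speaks of the variance.\<close>
    have "0 \<le> (- real N * s1 [])\<^sup>2 + (2 * (- real N * s1 []) + 1) * real N * s1 []
        + real N * (real N - 1) * s2 []"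
      using pos[of "- real N * s1 []" "[]" N] by (simp add: total)
    also have "\<dots> = real N * ((s1 [] - s2 []) - real N * ((s1 [])\<^sup>2 - s2 []))"
      by (simp add: power2_eq_square algebra_simps)
    also have "\<dots> < 0"
      using N \<open>N > 0\<close> by (simp add: mult_pos_neg)
    finally show False by simp
  qed
  then show ?thesis by (simp add: s1_def s2_def)
qed

section \<open>Derivatives of powers at the point (1, ..., 1)\<close>

lemma E_2_6_one: "E_2_6 1 = 15"
  by (simp add: E_2_6_eq sum_6)

lemma one_pos_orthant: "(1 :: real^'n) \<in> pos_orthant"
  by (simp add: pos_orthant_def)

lemma ev_pd1_EPow: "ev (pd i (EPow c)) 1 = 5 * c * 15 powr c / 15"
  by (simp add: E_2_6_one powr_diff sum_6)

lemma ev_pd2_EPow: "ev (pd i (pd i (EPow c))) 1 = 25 * c * (c - 1) * 15 powr c / 15 ^ 2"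
  by (simp add: E_2_6_one powr_diff sum_6 field_simps)

text \<open>At 1 the first derivatives of \<open>E_2_6\<close> are 5 and the second ones are 1 for
  distinct indices, 0 for equal ones. For \<open>i \<noteq> j\<close> there are 4 ways to pair one
  \<open>i\<close> with one \<open>j\<close> and 2 ways to pair both, whence
  \<open>4 * 25 * 15 = 1500\<close> and \<open>2 * 15 ^ 2 = 450\<close>.\<close>

lemma ev_pd4_EPow:
  "ev (pd i (pd i (pd j (pd j (EPow c))))) 1 = c * (c - 1) * 15 powr c / 15 ^ 4 *
     (625 * (c - 2) * (c - 3) + (if i = j then 0 else 1500 * (c - 2) + 450))"
  by (cases "i = j") (simp_all add: E_2_6_one powr_diff sum_6 field_simps)

lemma completely_monotone_E_2_6_powr_D:
  fixes \<beta> :: real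
  assumes cm: "completely_monotone (\<lambda>x. E_2_6 x powr (- \<beta>))"
  shows "\<beta> = 0 \<or> \<beta> \<ge> 2"
proof (rule ccontr)
  assume "\<not> ?thesis"
  then have \<beta>: "\<beta> \<noteq> 0" "\<beta> < 2" by auto
  let ?d = "\<lambda>is. ev (foldr pd is (EPow (- \<beta>))) 1"
  have sign: "0 \<le> (-1) ^ length is * ?d is" for "is"
  proof -
    have "(\<lambda>x. E_2_6 x powr (- \<beta>)) = ev (EPow (- \<beta>))" by (simp add: fun_eq_iff)
    then show ?thesis
      using cm iter_partial_ev[OF one_pos_orthant] one_pos_orthant
      unfolding completely_monotone_def by metis
  qed
  have "\<beta> > 0"
    using sign[of "[0]"] \<beta>(1) by (simp add: ev_pd1_EPow zero_le_mult_iff del: pd.simps)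
  \<comment> \<open>By \<open>euler_EPow\<close> the signed derivatives at 1 that extend a word of
    length \<open>k\<close> sum to \<open>2 * \<beta> + k\<close> times that of the word itself; the
    Pochhammer symbol collects these factors.\<close>
  define c where "c is = (-1) ^ length is * ?d is / (15 powr (- \<beta>) * pochhammer (2 * \<beta>) (length is))"
    for "is"
  \<comment> \<open>The letters are now consecutive pairs of indices, so that the event of equal
    indices becomes the diagonal \<open>?A\<close>.\<close>
  define q where "q ps = c (concat (map (\<lambda>(i, j). [i, j]) ps))" for ps
  have poch: "pochhammer (2 * \<beta>) n > 0" for n
    using \<open>\<beta> > 0\<close> by (simp add: pochhammer_pos)
  have c_swap: "c (s @ i # j # r) = c (s @ j # i # r)" for s i j r
    unfolding c_def using foldr_pd_swap[OF one_pos_orthant] by simp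
  have c_marginal: "(\<Sum>i\<in>UNIV. c (i # r)) = c r" for r
  proof -
    have "(\<Sum>i\<in>UNIV. c (i # r)) = (-1) ^ Suc (length r) * (\<Sum>i\<in>UNIV. ?d (i # r))
        / (15 powr (- \<beta>) * pochhammer (2 * \<beta>) (Suc (length r)))"
      unfolding c_def by (simp only: sum_distrib_left sum_divide_distrib list.size) simp
    also have "(\<Sum>i\<in>UNIV. ?d (i # r)) = - (2 * \<beta> + real (length r)) * ?d r"
      using euler_EPow[OF one_pos_orthant, of r "- \<beta>"] by (simp add: algebra_simps)
    also have "(-1) ^ Suc (length r) * (- (2 * \<beta> + real (length r)) * ?d r)
        / (15 powr (- \<beta>) * pochhammer (2 * \<beta>) (Suc (length r))) = c r"
    proof -
      define k where "k = 2 * \<beta> + real (length r)"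
      have "k > 0" using \<open>\<beta> > 0\<close> by (simp add: k_def add_pos_nonneg)
      then show ?thesis
        unfolding c_def pochhammer_Suc power_Suc k_def[symmetric] by simp
    qed
    finally show ?thesis .
  qed
  let ?A = "range (\<lambda>i. (i, i)) :: (6 \<times> 6) set"
  have "(\<Sum>p\<in>?A. q [p])\<^sup>2 \<le> (\<Sum>p\<in>?A. \<Sum>p'\<in>?A. q [p', p])"
  proof (rule exchangeable_second_moment)
    show "0 \<le> q r" for r
      unfolding q_def c_def using sign poch by (intro divide_nonneg_pos mult_pos_pos) auto
    show "q [] = 1" by (simp add: q_def c_def E_2_6_one)
    show "(\<Sum>p\<in>UNIV. q (p # r)) = q r" for r
    proof -
      define R where "R = concat (map (\<lambda>(i, j). [i, j]) r)"
      have "(\<Sum>p\<in>UNIV. q (p # r)) = (\<Sum>(i, j)\<in>UNIV \<times> UNIV. c (i # j # R))"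
        unfolding UNIV_Times_UNIV by (intro sum.cong) (auto simp: q_def R_def)
      also have "\<dots> = (\<Sum>i\<in>UNIV. \<Sum>j\<in>UNIV. c (i # j # R))"
        by (rule sum.cartesian_product[symmetric])
      also have "\<dots> = (\<Sum>j\<in>UNIV. \<Sum>i\<in>UNIV. c (i # j # R))"
        by (rule sum.swap)
      also have "\<dots> = q r" by (simp add: c_marginal q_def R_def)
      finally show ?thesis .
    qed
    show "q (s @ p # p' # r) = q (s @ p' # p # r)" for s p p' r
    proof -
      obtain i j k l where p: "p = (i, j)" "p' = (k, l)" by fastforce
      define S R where "S = concat (map (\<lambda>(i, j). [i, j]) s)" and "R = concat (map (\<lambda>(i, j). [i, j]) r)"
      \<comment> \<open>Exchanging two blocks of length two takes four adjacent
        transpositions.\<close>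
      have "c (S @ i # j # k # l # R) = c (S @ i # k # j # l # R)"
        using c_swap[of "S @ [i]"] by simp
      also have "\<dots> = c (S @ k # i # j # l # R)" by (rule c_swap)
      also have "\<dots> = c (S @ k # i # l # j # R)" using c_swap[of "S @ [k, i]"] by simp
      also have "\<dots> = c (S @ k # l # i # j # R)" using c_swap[of "S @ [k]"] by simp
      finally show ?thesis by (simp add: q_def p S_def R_def)
    qed
  qed
  moreover have "(\<Sum>p\<in>?A. q [p]) = (\<beta> + 1) / (3 * (2 * \<beta> + 1))"
  proof -
    have "(\<Sum>p\<in>?A. q [p]) = (\<Sum>i\<in>UNIV. c [i, i])"
      by (subst sum.reindex) (auto simp: inj_on_def q_def)
    also have "\<dots> = (\<Sum>i\<in>(UNIV::6 set). 25 * (- \<beta>) * (- \<beta> - 1) / 15\<^sup>2 / pochhammer (2 * \<beta>) 2)"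
      unfolding c_def
      by (intro sum.cong refl) (simp add: ev_pd2_EPow del: pd.simps flip: numeral_2_eq_2)
    also have "pochhammer (2 * \<beta>) 2 = 2 * \<beta> * (2 * \<beta> + 1)"
      by (simp add: pochhammer_Suc eval_nat_numeral)
    also have "(\<Sum>i\<in>(UNIV::6 set). 25 * (- \<beta>) * (- \<beta> - 1) / 15\<^sup>2 / (2 * \<beta> * (2 * \<beta> + 1)))
        = 6 * (25 * \<beta> * (\<beta> + 1) / (15\<^sup>2 * (2 * \<beta> * (2 * \<beta> + 1))))"
      by (simp add: algebra_simps)
    also have "\<dots> = (\<beta> + 1) / (3 * (2 * \<beta> + 1))"
      using \<open>\<beta> > 0\<close> by (simp add: divide_simps) algebra
    finally show ?thesis .
  qed
  moreover have "(\<Sum>p\<in>?A. \<Sum>p'\<in>?A. q [p', p])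
      = (5 * \<beta>\<^sup>2 + 15 * \<beta> + 13) / (45 * ((2 * \<beta> + 1) * (2 * \<beta> + 3)))"
  proof -
    let ?K = "625 * (- \<beta> - 2) * (- \<beta> - 3)" and ?L = "1500 * (- \<beta> - 2) + 450 :: real"
    have "(\<Sum>p\<in>?A. \<Sum>p'\<in>?A. q [p', p]) = (\<Sum>i\<in>UNIV. \<Sum>j\<in>UNIV. c [j, j, i, i])"
      by (subst (1 2) sum.reindex) (auto simp: inj_on_def q_def)
    also have "\<dots> = (\<Sum>i\<in>(UNIV::6 set). \<Sum>j\<in>UNIV. (- \<beta>) * (- \<beta> - 1) / 15 ^ 4 *
        (?K + (if j = i then 0 else ?L)) / pochhammer (2 * \<beta>) 4)"
      unfolding c_def by (intro sum.cong refl) (simp add: ev_pd4_EPow eval_nat_numeral mult.assoc del: pd.simps)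
    also have "\<dots> = (- \<beta>) * (- \<beta> - 1) / 15 ^ 4 / pochhammer (2 * \<beta>) 4 *
       (\<Sum>i\<in>(UNIV::6 set). \<Sum>j\<in>(UNIV::6 set). ?K + ?L - (if j = i then ?L else 0))"
      unfolding sum_distrib_left by (intro sum.cong refl) auto
    also have "(\<Sum>i\<in>(UNIV::6 set). \<Sum>j\<in>(UNIV::6 set). ?K + ?L - (if j = i then ?L else 0))
        = 36 * (?K + ?L) - 6 * ?L"
      by (simp add: sum_subtractf)
    also have "pochhammer (2 * \<beta>) 4 = 2 * \<beta> * (2 * \<beta> + 1) * (2 * \<beta> + 2) * (2 * \<beta> + 3)"
      by (simp add: pochhammer_Suc eval_nat_numeral)
    also have "(- \<beta>) * (- \<beta> - 1) / 15 ^ 4 / (2 * \<beta> * (2 * \<beta> + 1) * (2 * \<beta> + 2) * (2 * \<beta> + 3))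
        * (36 * (?K + ?L) - 6 * ?L) = (5 * \<beta>\<^sup>2 + 15 * \<beta> + 13) / (45 * ((2 * \<beta> + 1) * (2 * \<beta> + 3)))"
    proof -
      have "36 * (?K + ?L) - 6 * ?L = 4500 * (5 * \<beta>\<^sup>2 + 15 * \<beta> + 13)"
        by (simp add: power2_eq_square algebra_simps)
      moreover have "2 * \<beta> * (2 * \<beta> + 1) * (2 * \<beta> + 2) * (2 * \<beta> + 3)
          = 4 * ((- \<beta>) * (- \<beta> - 1)) * ((2 * \<beta> + 1) * (2 * \<beta> + 3))"
        by (simp add: algebra_simps)
      moreover have "u / 15 ^ 4 / (4 * u * v) * (4500 * w) = w / (45 * v)"
        if "u \<noteq> 0" for u v w :: real
        using that by simp
      moreover have "(- \<beta>) * (- \<beta> - 1) \<noteq> 0"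
        using \<open>\<beta> > 0\<close> by simp
      ultimately show ?thesis by (simp only: not_False_eq_True)
    qed
    finally show ?thesis .
  qed
  ultimately have ineq: "((\<beta> + 1) / (3 * (2 * \<beta> + 1)))\<^sup>2
      \<le> (5 * \<beta>\<^sup>2 + 15 * \<beta> + 13) / (45 * ((2 * \<beta> + 1) * (2 * \<beta> + 3)))"
    by simp
  have "(\<beta> + 1)\<^sup>2 * (45 * ((2 * \<beta> + 1) * (2 * \<beta> + 3)))
      \<le> (5 * \<beta>\<^sup>2 + 15 * \<beta> + 13) * (3 * (2 * \<beta> + 1))\<^sup>2"
  proof -
    have "a * d \<le> c * b" if "a / b \<le> c / d" "0 < b" "0 < d" for a b c d :: real
      using that by (simp add: field_simps)
    moreover have "0 < (3 * (2 * \<beta> + 1))\<^sup>2" "0 < 45 * ((2 * \<beta> + 1) * (2 * \<beta> + 3))"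
      using \<open>\<beta> > 0\<close> by simp_all
    ultimately show ?thesis
      using ineq unfolding power_divide by blast
  qed
  \<comment> \<open>Both sides have the factor \<open>9 * (2 * \<beta> + 1)\<close>; the cofactors
    agree in their cubic and quadratic terms and differ by \<open>\<beta> - 2\<close>.\<close>
  then have "0 \<le> 9 * (2 * \<beta> + 1) * (\<beta> - 2)"
    by (simp add: power2_eq_square algebra_simps)
  then show False
    using \<beta> \<open>\<beta> > 0\<close> by (simp add: zero_le_mult_iff)
qed

section \<open>Gaussian mixtures and sufficiency\<close>

lemma Gamma_integral_exp:
  fixes a \<gamma> :: real
  assumes "0 < a" "0 < \<gamma>"
  shows "((\<lambda>t. t powr (\<gamma> - 1) * exp (- (a * t))) has_integral Gamma \<gamma> * a powr (- \<gamma>)) {0..}"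
proof -
  let ?f = "\<lambda>t::real. t powr (\<gamma> - 1) / exp t"
  have img: "(\<lambda>t. a * t) ` {0..} = {0..}"
  proof (intro equalityI subsetI)
    fix y :: real assume "y \<in> {0..}"
    then show "y \<in> (\<lambda>t. a * t) ` {0..}"
      using assms by (intro image_eqI[of _ _ "y / a"]) auto
  qed (use assms in auto)
  have "?f absolutely_integrable_on {0..}"
    using Gamma_integral_real[OF assms(2)]
    by (intro nonnegative_absolutely_integrable_1) (auto simp: integrable_on_def)
  then have "(\<lambda>t. \<bar>a\<bar> * ?f (a * t)) absolutely_integrable_on {0..} \<and>
      integral {0..} (\<lambda>t. \<bar>a\<bar> * ?f (a * t)) = Gamma \<gamma>"
    using Gamma_integral_real[OF assms(2)] assms(1)
    by (subst has_absolute_integral_change_of_variables_1')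
      (auto simp: img integral_unique inj_on_def intro!: derivative_eq_intros)
  then have "((\<lambda>t. \<bar>a\<bar> * ?f (a * t)) has_integral Gamma \<gamma>) {0..}"
    by (auto simp: has_integral_iff dest: absolutely_integrable_on_def[THEN iffD1])
  then have "((\<lambda>t. a powr (- \<gamma>) * (\<bar>a\<bar> * ?f (a * t))) has_integral a powr (- \<gamma>) * Gamma \<gamma>) {0..}"
    by (rule has_integral_mult_right)
  moreover have "a powr (- \<gamma>) * (\<bar>a\<bar> * ?f (a * t)) = t powr (\<gamma> - 1) * exp (- (a * t))"
    if "t \<in> {0..}" for t
    using that assms by (simp add: powr_mult powr_diff powr_minus exp_minus field_simps)
  ultimately show ?thesis
    unfolding mult.commute[of "Gamma \<gamma>"] by (rule has_integral_eq[rotated])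
qed

text \<open>For positive \<open>\<gamma>\<close> the Gamma integral makes the power a mixture of
  decreasing exponentials; for \<open>\<gamma> = 0\<close> it is the constant 1.\<close>

lemma alternating_powr_inner:
  assumes c: "\<And>i. 0 \<le> c $ i" and pos: "\<And>x. x \<in> pos_orthant \<Longrightarrow> 0 < c \<bullet> x" and "0 \<le> \<gamma>"
  shows "alternating n (\<lambda>x. (c \<bullet> x) powr (- \<gamma>))"
proof (cases "\<gamma> = 0")
  case True
  then show ?thesis
    using alternating_cong[OF alternating_const[of 1 n], of "\<lambda>x. (c \<bullet> x) powr (- \<gamma>)"] pos
    by fastforce
next
  case False
  then have "0 < \<gamma>" using \<open>0 \<le> \<gamma>\<close> by simp
  have "alternating n (\<lambda>x. Gamma \<gamma> * (c \<bullet> x) powr (- \<gamma>))"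
  proof (rule alternating_integral)
    show "alternating n (\<lambda>x. t powr (\<gamma> - 1) * exp (- ((t *\<^sub>R c) \<bullet> x)))" if "t \<in> {0..}" for t
      using that c by (intro alternating_mult alternating_const alternating_exp) auto
    show "((\<lambda>t. t powr (\<gamma> - 1) * exp (- ((t *\<^sub>R c) \<bullet> x))) has_integral
        Gamma \<gamma> * (c \<bullet> x) powr (- \<gamma>)) {0..}" if "x \<in> pos_orthant" for x
      using Gamma_integral_exp[OF pos[OF that] \<open>0 < \<gamma>\<close>] by (simp add: mult.commute)
  qed
  then show ?thesis
    using Gamma_real_pos[OF \<open>0 < \<gamma>\<close>] by (rule alternating_cmult_D)
qed

text \<open>The exponent is minus half the second central moment of \<open>p\<close> under the weights \<open>w $ i * x $ i\<close>.\<close>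

lemma alternating_gaussian:
  fixes w :: "real^'n" and p :: "'n \<Rightarrow> real"
  assumes w: "\<And>i. 0 \<le> w $ i" and pos: "\<And>x. x \<in> pos_orthant \<Longrightarrow> 0 < w \<bullet> x"
  shows "alternating n (\<lambda>x. (w \<bullet> x) powr (- 1 / 2) *
    exp (- ((\<Sum>i\<in>UNIV. w $ i * x $ i * (p i)\<^sup>2) - (\<Sum>i\<in>UNIV. w $ i * x $ i * p i)\<^sup>2 / (w \<bullet> x)) / 2))"
    (is "alternating n ?g")
proof -
  have "alternating n (\<lambda>x. sqrt (2 * pi) * ?g x)"
  proof (rule alternating_integral)
    \<comment> \<open>For each fixed \<open>z\<close> the exponent is linear in \<open>x\<close>
      with nonnegative coefficients; \<open>z\<close> is the mixing parameter.\<close>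
    let ?c = "\<lambda>z. (\<chi> i. w $ i * (z - p i)\<^sup>2 / 2) :: real^'n"
    show "alternating n (\<lambda>x. exp (- (?c z \<bullet> x)))" for z
      by (intro alternating_exp) (simp add: w)
    fix x :: "real^'n" assume "x \<in> pos_orthant"
    define S M V where "S = w \<bullet> x" and "M = (\<Sum>i\<in>UNIV. w $ i * x $ i * p i)"
      and "V = (\<Sum>i\<in>UNIV. w $ i * x $ i * (p i)\<^sup>2)"
    have "S > 0" using pos[OF \<open>x \<in> pos_orthant\<close>] by (simp add: S_def)
    \<comment> \<open>Parallel axis theorem: completing the square splits the moment about
      \<open>z\<close> into the one about the barycentre \<open>M / S\<close> and the exponent of a
      normal density.\<close>
    have c: "?c z \<bullet> x = S / 2 * (z - M / S)\<^sup>2 + (V - M\<^sup>2 / S) / 2" for z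
    proof -
      have "?c z \<bullet> x = (\<Sum>i\<in>UNIV. z\<^sup>2 / 2 * (w $ i * x $ i) - z * (w $ i * x $ i * p i)
          + 1 / 2 * (w $ i * x $ i * (p i)\<^sup>2))"
        unfolding inner_vec_def by (intro sum.cong) (simp_all add: power2_eq_square field_simps)
      also have "\<dots> = z\<^sup>2 / 2 * S - z * M + 1 / 2 * V"
        unfolding sum.distrib sum_subtractf sum_distrib_left[symmetric]
        by (simp add: S_def M_def V_def inner_vec_def)
      also have "\<dots> = S / 2 * (z - M / S)\<^sup>2 + (V - M\<^sup>2 / S) / 2"
        using \<open>S > 0\<close> by (simp add: power2_eq_square field_simps)
      finally show ?thesis .
    qed
    have "((\<lambda>z. sqrt (2 * pi) * ?g x * normal_density (M / S) (1 / sqrt S) z) has_integral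
        sqrt (2 * pi) * ?g x * 1) UNIV"
      using has_integral_integral_lborel[OF integrable_normal_density[of "1 / sqrt S" "M / S"]]
        integral_normal_density[of "1 / sqrt S" "M / S"] \<open>S > 0\<close>
      by (intro has_integral_mult_right) simp
    moreover have "sqrt (2 * pi) * ?g x * normal_density (M / S) (1 / sqrt S) z = exp (- (?c z \<bullet> x))" for z
    proof -
      have "?g x = S powr (- 1 / 2) * exp (- (V - M\<^sup>2 / S) / 2)"
        by (simp add: S_def M_def V_def)
      moreover have "S powr (- 1 / 2) = 1 / sqrt S"
      proof -
        have "S powr (- 1 / 2) = inverse (S powr (1 / 2))"
          by (simp only: minus_divide_left[symmetric] powr_minus)
        also have "\<dots> = 1 / sqrt S"
          using powr_half_sqrt[of S] \<open>S > 0\<close> by (simp only: inverse_eq_divide less_imp_le)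
        finally show ?thesis .
      qed
      moreover have "normal_density (M / S) (1 / sqrt S) z
          = sqrt S / sqrt (2 * pi) * exp (- (S / 2 * (z - M / S)\<^sup>2))"
        using \<open>S > 0\<close> by (simp add: normal_density_def power_divide real_sqrt_divide)
      moreover have "sqrt (2 * pi) * (1 / sqrt S * a) * (sqrt S / sqrt (2 * pi) * b) = b * a" for a b
        using \<open>S > 0\<close> by simp
      moreover have "- (?c z \<bullet> x) = - (S / 2 * (z - M / S)\<^sup>2) + - (V - M\<^sup>2 / S) / 2"
        by (simp only: c minus_add_distrib minus_divide_left)
      ultimately show ?thesis by (simp only: exp_add)
    qed
    ultimately show "((\<lambda>z. exp (- (?c z \<bullet> x))) has_integral sqrt (2 * pi) * ?g x) UNIV"
      by simp
  qed
  then show ?thesis by (rule alternating_cmult_D) simp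
qed

lemma alternating_E_2_6_powr:
  fixes \<beta> :: real
  assumes "2 \<le> \<beta>"
  shows "alternating n (\<lambda>x. E_2_6 x powr (- \<beta>))"
proof -
  define w :: "real^6" where "w = (\<chi> i. if i = 0 then 0 else 1)"
  \<comment> \<open>\<open>p 1\<close>, \<dots>, \<open>p 4\<close> are the four coordinates of the vertices, indexed by 1, \<dots>, 5, of a regular
    simplex with edge length \<open>sqrt 2\<close>; the value of \<open>\<tau>\<close> makes the last vertex equidistant.\<close>
  define \<tau> :: real where "\<tau> = (1 + sqrt 5) / 4"
  define p :: "6 \<Rightarrow> 6 \<Rightarrow> real" where "p j i = (if i = j then 1 else if i = 5 then \<tau> else 0)" for j i
  \<comment> \<open>This says that the squared distance
    \<open>(1 - \<tau>)\<^sup>2 + 3 * \<tau>\<^sup>2\<close> from the last vertex to each other one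
    is 2.\<close>
  have \<tau>: "4 * \<tau>\<^sup>2 = 2 * \<tau> + 1"
    by (simp add: \<tau>_def power2_eq_square field_simps)
  have w: "w \<bullet> x = x $ 1 + x $ 2 + x $ 3 + x $ 4 + x $ 5" for x
    by (simp add: w_def inner_vec_def sum_6)
  have w_pos: "0 < w \<bullet> x" if "x \<in> pos_orthant" for x
    using that by (simp add: w pos_orthant_def add_pos_pos)
  \<comment> \<open>\<open>g s j\<close> is the Gaussian factor for coordinate \<open>j\<close> of
    the vertices scaled by \<open>sqrt s\<close>. The four factors supply the power -2 of
    \<open>w \<bullet> x\<close>, which leaves \<open>- (\<beta> - 2)\<close> in
    \<open>G\<close>.\<close>
  define g where "g s j x = (w \<bullet> x) powr (- 1 / 2) *
    exp (- ((\<Sum>i\<in>UNIV. w $ i * x $ i * (sqrt s * p j i)\<^sup>2)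
          - (\<Sum>i\<in>UNIV. w $ i * x $ i * (sqrt s * p j i))\<^sup>2 / (w \<bullet> x)) / 2)" for s j x
  define G where "G s x = s powr (\<beta> - 1) * (exp (- ((s *\<^sub>R axis 0 1) \<bullet> x)) *
    (w \<bullet> x) powr (- (\<beta> - 2)) * (\<Prod>j\<in>{1, 2, 3, 4}. g s j x))" for s x
  have G_eq: "G s x = (w \<bullet> x) powr (- \<beta>) * (s powr (\<beta> - 1) * exp (- (E_2_6 x / (w \<bullet> x) * s)))"
    if x: "x \<in> pos_orthant" and s: "0 \<le> s" for s x
  proof -
    define S where "S = w \<bullet> x"
    have "S > 0" using w_pos[OF x] by (simp add: S_def)
    define h where "h j = x $ j + \<tau>\<^sup>2 * x $ 5 - (x $ j + \<tau> * x $ 5)\<^sup>2 / S" for j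
    have g: "g s j x = S powr (- 1 / 2) * exp (- (s * h j / 2))" if "j \<in> {1, 2, 3, 4}" for j
    proof -
      have "(\<Sum>i\<in>UNIV. w $ i * x $ i * (sqrt s * p j i)\<^sup>2) = s * (x $ j + \<tau>\<^sup>2 * x $ 5)"
        using that s by (auto simp: sum_6 w_def p_def power_mult_distrib algebra_simps)
      moreover have "(\<Sum>i\<in>UNIV. w $ i * x $ i * (sqrt s * p j i)) = sqrt s * (x $ j + \<tau> * x $ 5)"
        using that by (auto simp: sum_6 w_def p_def algebra_simps)
      moreover have "s * (x $ j + \<tau>\<^sup>2 * x $ 5) - (sqrt s * (x $ j + \<tau> * x $ 5))\<^sup>2 / S = s * h j"
        using s by (simp add: h_def power_mult_distrib right_diff_distrib)
      ultimately show ?thesis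
        by (simp only: g_def S_def minus_divide_left)
    qed
    have "(\<Prod>j\<in>{1, 2, 3, 4}. g s j x)
        = (S powr (- 1 / 2)) ^ 4 * exp (- (s * (h 1 + h 2 + h 3 + h 4) / 2))"
      using \<open>S > 0\<close> by (simp add: g power4_eq_xxxx distrib_left add_divide_distrib exp_add[symmetric])
    also have "(S powr (- 1 / 2)) ^ 4 = S powr (- 2)"
      using \<open>S > 0\<close> by (simp add: powr_power)
    finally have "G s x = s powr (\<beta> - 1) * (S powr (- (\<beta> - 2)) * S powr (- 2)) *
        (exp (- (s * x $ 0)) * exp (- (s * (h 1 + h 2 + h 3 + h 4) / 2)))"
      by (simp add: G_def S_def inner_axis' mult_ac)
    also have "S powr (- (\<beta> - 2)) * S powr (- 2) = S powr (- \<beta>)"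
      by (simp flip: powr_add)
    also have "exp (- (s * x $ 0)) * exp (- (s * (h 1 + h 2 + h 3 + h 4) / 2))
        = exp (- ((x $ 0 + (h 1 + h 2 + h 3 + h 4) / 2) * s))"
      by (simp add: algebra_simps add_divide_distrib flip: exp_add)
    also have "x $ 0 + (h 1 + h 2 + h 3 + h 4) / 2 = E_2_6 x / S"
    proof -
      have S: "S = x $ 1 + x $ 2 + x $ 3 + x $ 4 + x $ 5" by (simp add: S_def w)
      \<comment> \<open>Once \<open>4 * \<tau>\<^sup>2\<close> is replaced by
        \<open>2 * \<tau> + 1\<close>, all terms containing \<open>\<tau>\<close> cancel.\<close>
      have "S * (2 * x $ 0 + (h 1 + h 2 + h 3 + h 4))
          = S * (2 * x $ 0 + x $ 1 + x $ 2 + x $ 3 + x $ 4 + (4 * \<tau>\<^sup>2) * x $ 5)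
          - ((x $ 1)\<^sup>2 + (x $ 2)\<^sup>2 + (x $ 3)\<^sup>2 + (x $ 4)\<^sup>2
             + 2 * \<tau> * x $ 5 * (x $ 1 + x $ 2 + x $ 3 + x $ 4) + (4 * \<tau>\<^sup>2) * (x $ 5)\<^sup>2)"
        using \<open>S > 0\<close> by (simp add: h_def power2_eq_square field_simps)
      also have "\<dots> = 2 * E_2_6 x"
        unfolding \<tau> S E_2_6_eq sum_6 by (simp add: power2_eq_square algebra_simps)
      finally show ?thesis using \<open>S > 0\<close> by (simp add: field_simps)
    qed
    finally show ?thesis by (simp add: S_def)
  qed
  have "alternating n (\<lambda>x. Gamma \<beta> * E_2_6 x powr (- \<beta>))"
  proof (rule alternating_integral)
    \<comment> \<open>Here \<open>2 \<le> \<beta>\<close> makes \<open>\<beta> - 2\<close> an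
      admissible exponent for \<open>alternating_powr_inner\<close>.\<close>
    show "alternating n (G s)" if "s \<in> {0..}" for s
      unfolding G_def g_def using that assms w_pos
      by (intro alternating_mult alternating_const alternating_exp alternating_powr_inner
          alternating_prod alternating_gaussian) (auto simp: w_def axis_def)
    fix x :: "real^6" assume x: "x \<in> pos_orthant"
    have "((\<lambda>s. s powr (\<beta> - 1) * exp (- (E_2_6 x / (w \<bullet> x) * s))) has_integral
        Gamma \<beta> * (E_2_6 x / (w \<bullet> x)) powr (- \<beta>)) {0..}"
      using assms E_2_6_pos[OF x] w_pos[OF x] by (intro Gamma_integral_exp) auto
    then have "((\<lambda>s. (w \<bullet> x) powr (- \<beta>) * (s powr (\<beta> - 1) * exp (- (E_2_6 x / (w \<bullet> x) * s))))
        has_integral (w \<bullet> x) powr (- \<beta>) * (Gamma \<beta> * (E_2_6 x / (w \<bullet> x)) powr (- \<beta>))) {0..}"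
      by (rule has_integral_mult_right)
    moreover have "(w \<bullet> x) powr (- \<beta>) * (Gamma \<beta> * (E_2_6 x / (w \<bullet> x)) powr (- \<beta>))
        = Gamma \<beta> * E_2_6 x powr (- \<beta>)"
      using E_2_6_pos[OF x] w_pos[OF x] by (simp add: powr_divide)
    ultimately show "((\<lambda>s. G s x) has_integral Gamma \<beta> * E_2_6 x powr (- \<beta>)) {0..}"
      using has_integral_cong[of "{0..}" "\<lambda>s. G s x", OF G_eq[OF x]] by (simp only: atLeast_iff)
  qed
  then show ?thesis
    by (rule alternating_cmult_D) (use assms in \<open>simp add: Gamma_real_pos\<close>)
qed

theorem corollary1p7:
  fixes \<beta> :: real
  shows "completely_monotone (\<lambda>x. E_2_6 x powr (- \<beta>)) \<longleftrightarrow> \<beta> = 0 \<or> \<beta> \<ge> 2"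
proof
  assume "\<beta> = 0 \<or> \<beta> \<ge> 2"
  then have "alternating n (\<lambda>x. E_2_6 x powr (- \<beta>))" for n
  proof
    assume "\<beta> = 0"
    \<comment> \<open>Since \<open>0 powr 0 = 0\<close> in HOL, positivity of \<open>E_2_6\<close>
      is what makes the power constantly 1.\<close>
    then show ?thesis
      using alternating_cong[OF alternating_const[of 1 n], of "\<lambda>x. E_2_6 x powr (- \<beta>)"] E_2_6_pos
      by fastforce
  qed (rule alternating_E_2_6_powr)
  moreover have "smooth_on pos_orthant (\<lambda>x. E_2_6 x powr (- \<beta>))"
    using smooth_on_ev[of "EPow (- \<beta>)"] by (simp add: ev.simps[abs_def])
  ultimately show "completely_monotone (\<lambda>x. E_2_6 x powr (- \<beta>))"
    by (intro completely_monotone_if_alternating)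
qed (rule completely_monotone_E_2_6_powr_D)

end
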